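(* Let $\mathbb{E}_1,\mathbb{E}_2$ be Euclidean spaces, let $g:\mathbb{E}_2\to\mathbb{R}\cup\{+\infty\}$ be proper, convex and lower semicontinuous, and let $F:D\to\mathbb{E}_2$ with $D\subset\mathbb{E}_1$ convex be such that $g\circ F$ is proper. Then the following statements are equivalent: (i) There exists a cone $K\subset\mathbb{E}_2$ such that $g$ is $K$-increasing and $F$ is $K$-convex; (ii) $g$ is $K_F$-increasing; (iii) $K_F\subset-\mathrm{hzn}\,g$; (iv) $(\mathrm{hzn}\,g)^\circ\subset-K_F^\circ$.
   Context: A Euclidean space is a finite-dimensional real inner product space. A cone is a nonempty set $K$ with $\lambda x\in K$ for all $\lambda\ge0$, $x\in K$; $K^\circ:=\{v : \langle u,v\rangle\le0\ \forall u\in K\}$. $F$ is $K$-convex if $K\text{-}\mathrm{epi}\,F:=\{(x,y)\in D\times\mathbb{E}_2 : y-F(x)\in K\}$ is convex. $K_F$ is the smallest closed convex cone $K\subset\mathbb{E}_2$ such that $F$ is $K$-convex, i.e. the intersection of all closed convex cones with respect to which $F$ is convex ($F$ is $K_F$-convex). $g$ is $K$-increasing if $y-x\in K$ implies $g(y)\ge g(x)$ for all $x,y\in\mathbb{E}_2$. $(g\circ F)(x):=g(F(x))$ for $x\in D$ and $+\infty$ otherwise; it is proper if it is finite at some point (and never $-\infty$). For a set $C$, $C^\infty:=\{u : \exists\,t_k\downarrow0,\ x_k\in C,\ t_kx_k\to u\}$. The horizon function $g^\infty$ is defined by $\mathrm{epi}\,g^\infty=(\mathrm{epi}\,g)^\infty$,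 where $\mathrm{epi}\,g=\{(x,\alpha)\in\mathbb{E}_2\times\mathbb{R} : g(x)\le\alpha\}$, and the horizon cone of $g$ is $\mathrm{hzn}\,g:=\{x\in\mathbb{E}_2 : g^\infty(x)\le0\}$. *)

theory Defs
  imports "HOL-Analysis.Analysis"
begin

text \<open>Functions with values in \<open>\<real> \<union> {+\<infinity>}\<close> are modelled as functions into
  \<^typ>\<open>ereal\<close>; the value \<open>-\<infinity>\<close> is excluded by \<open>proper_fun\<close>.\<close>

definition proper_fun :: "('a \<Rightarrow> ereal) \<Rightarrow> bool"
  where "proper_fun f \<longleftrightarrow> (\<exists>x. \<bar>f x\<bar> \<noteq> \<infinity>) \<and> (\<forall>x. f x \<noteq> - \<infinity>)"

definition epi :: "('a \<Rightarrow> ereal) \<Rightarrow> ('a \<times> real) set"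
  where "epi f = {(x, \<alpha>). f x \<le> ereal \<alpha>}"

definition convex_fun :: "('a::real_vector \<Rightarrow> ereal) \<Rightarrow> bool"
  where "convex_fun f \<longleftrightarrow> convex (epi f)"

definition lsc_fun :: "('a::topological_space \<Rightarrow> ereal) \<Rightarrow> bool"
  where "lsc_fun f \<longleftrightarrow> (\<forall>x. f x \<le> Liminf (nhds x) f)"

text \<open>A map \<open>F : D \<rightarrow> E\<close> is a total function together with its domain \<open>D\<close>;
  the values of \<open>F\<close> outside \<open>D\<close> are never used.\<close>

definition comp_on :: "('b \<Rightarrow> ereal) \<Rightarrow> 'a set \<Rightarrow> ('a \<Rightarrow> 'b) \<Rightarrow> 'a \<Rightarrow> ereal"
  where "comp_on g D F = (\<lambda>x. if x \<in> D then g (F x) else \<infinity>)"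

definition K_epi :: "'b set \<Rightarrow> 'a set \<Rightarrow> ('a \<Rightarrow> 'b::ab_group_add) \<Rightarrow> ('a \<times> 'b) set"
  where "K_epi K D F = {(x, y). x \<in> D \<and> y - F x \<in> K}"

definition K_convex :: "'b set \<Rightarrow> 'a::real_vector set \<Rightarrow> ('a \<Rightarrow> 'b::real_vector) \<Rightarrow> bool"
  where "K_convex K D F \<longleftrightarrow> convex (K_epi K D F)"

definition K_increasing :: "'b::ab_group_add set \<Rightarrow> ('b \<Rightarrow> ereal) \<Rightarrow> bool"
  where "K_increasing K g \<longleftrightarrow> (\<forall>x y. y - x \<in> K \<longrightarrow> g x \<le> g y)"

text \<open>The library predicate \<^const>\<open>cone\<close> admits the empty set, whereas
  \<^const>\<open>convex_cone\<close> includes nonemptiness.\<close>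

definition min_cone ::
    "'a::real_vector set \<Rightarrow> ('a \<Rightarrow> 'b::real_normed_vector) \<Rightarrow> 'b set"
  where "min_cone D F = \<Inter> {K. convex_cone K \<and> closed K \<and> K_convex K D F}"

definition polar_cone :: "'b::real_inner set \<Rightarrow> 'b set"
  where "polar_cone K = {v. \<forall>u\<in>K. u \<bullet> v \<le> 0}"

definition horizon_cone :: "'a::real_normed_vector set \<Rightarrow> 'a set"
  where "horizon_cone C = {u. \<exists>(t :: nat \<Rightarrow> real) x.
           (\<forall>k. t k > 0) \<and> t \<longlonglongrightarrow> 0 \<and> (\<forall>k. x k \<in> C) \<and> (\<lambda>k. t k *\<^sub>R x k) \<longlonglongrightarrow> u}"

text \<open>The horizon function is the unique function whose epigraph is the horizon cone of
  \<open>epi g\<close>; see \<open>epi_horizon_fun\<close> below.\<close>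

definition horizon_fun :: "('b::real_normed_vector \<Rightarrow> ereal) \<Rightarrow> 'b \<Rightarrow> ereal"
  where "horizon_fun g x = Inf {ereal \<alpha> | \<alpha>. (x, \<alpha>) \<in> horizon_cone (epi g)}"

definition hzn :: "('b::real_normed_vector \<Rightarrow> ereal) \<Rightarrow> 'b set"
  where "hzn g = {x. horizon_fun g x \<le> 0}"


lemma horizon_cone_iff:
  "u \<in> horizon_cone C \<longleftrightarrow> (\<forall>e>0. \<exists>t x. 0 < t \<and> t < e \<and> x \<in> C \<and> dist (t *\<^sub>R x) u < e)"
  (is "?L \<longleftrightarrow> ?R")
proof
  assume ?L
  then obtain t :: "nat \<Rightarrow> real" and x where t: "\<And>k. t k > 0" "t \<longlonglongrightarrow> 0" "\<And>k. x k \<in> C"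
    and lim: "(\<lambda>k. t k *\<^sub>R x k) \<longlonglongrightarrow> u"
    unfolding horizon_cone_def by blast
  show ?R
  proof (intro allI impI)
    fix e :: real assume e: "e > 0"
    have "\<forall>\<^sub>F k in sequentially. t k < e \<and> dist (t k *\<^sub>R x k) u < e"
      using order_tendstoD(2)[OF t(2) e] tendstoD[OF lim e] by eventually_elim auto
    then obtain k where "t k < e" "dist (t k *\<^sub>R x k) u < e"
      using eventually_happens'[OF sequentially_bot] by blast
    then show "\<exists>t x. 0 < t \<and> t < e \<and> x \<in> C \<and> dist (t *\<^sub>R x) u < e"
      using t by blast
  qed
next
  assume R: ?R
  have "\<exists>t x. 0 < t \<and> t < inverse (Suc k) \<and> x \<in> C \<and> dist (t *\<^sub>R x) u < inverse (Suc k)" for k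
    using R by simp
  then obtain t :: "nat \<Rightarrow> real" and x where
    *: "\<And>k. 0 < t k" "\<And>k. t k < inverse (Suc k)" "\<And>k. x k \<in> C"
       "\<And>k. dist (t k *\<^sub>R x k) u < inverse (Suc k)"
    by metis
  have "t \<longlonglongrightarrow> 0"
    by (rule tendsto_sandwich[OF _ _ tendsto_const LIMSEQ_inverse_real_of_nat])
       (use * in \<open>auto intro!: always_eventually less_imp_le\<close>)
  moreover have "(\<lambda>k. dist (t k *\<^sub>R x k) u) \<longlonglongrightarrow> 0"
    by (rule tendsto_sandwich[OF _ _ tendsto_const LIMSEQ_inverse_real_of_nat])
       (use * in \<open>auto intro!: always_eventually less_imp_le\<close>)
  then have "(\<lambda>k. t k *\<^sub>R x k) \<longlonglongrightarrow> u"
    by (simp only: tendsto_dist_iff[symmetric])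
  ultimately show ?L
    unfolding horizon_cone_def using * by blast
qed

lemma closed_horizon_cone: "closed (horizon_cone C)"
proof -
  have "closure (horizon_cone C) \<subseteq> horizon_cone C"
  proof
    fix u assume u: "u \<in> closure (horizon_cone C)"
    show "u \<in> horizon_cone C"
      unfolding horizon_cone_iff
    proof (intro allI impI)
      fix e :: real assume e: "e > 0"
      then obtain v where v: "v \<in> horizon_cone C" "dist v u < e / 2"
        using u unfolding closure_approachable by (meson half_gt_zero)
      then obtain t x where t: "0 < t" "t < e / 2" "x \<in> C" "dist (t *\<^sub>R x) v < e / 2"
        using e unfolding horizon_cone_iff by (meson half_gt_zero)
      have "dist (t *\<^sub>R x) u < e"
        using dist_triangle[of "t *\<^sub>R x" u v] t(4) v(2) by linarith
      then show "\<exists>t x. 0 < t \<and> t < e \<and> x \<in> C \<and> dist (t *\<^sub>R x) u < e"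
        using t e by (intro exI[of _ t] exI[of _ x]) auto
    qed
  qed
  then show ?thesis by (simp add: closure_subset_eq)
qed

lemma horizon_cone_epi_upward:
  assumes "(x, \<alpha>) \<in> horizon_cone (epi g)" "\<alpha> \<le> \<beta>"
  shows "(x, \<beta>) \<in> horizon_cone (epi g)"
proof -
  obtain t :: "nat \<Rightarrow> real" and z where t: "\<And>k. t k > 0" "t \<longlonglongrightarrow> 0" "\<And>k. z k \<in> epi g"
    and lim: "(\<lambda>k. t k *\<^sub>R z k) \<longlonglongrightarrow> (x, \<alpha>)"
    using assms(1) unfolding horizon_cone_def by blast
  define w where "w k = (fst (z k), snd (z k) + (\<beta> - \<alpha>) / t k)" for k
  have "w k \<in> epi g" for k
  proof -
    have "g (fst (z k)) \<le> ereal (snd (z k))"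
      using t(3)[of k] by (auto simp: epi_def split: prod.splits)
    also have "\<dots> \<le> ereal (snd (z k) + (\<beta> - \<alpha>) / t k)"
      using t(1)[of k] assms(2) by simp
    finally show ?thesis by (simp add: w_def epi_def)
  qed
  moreover have "t k *\<^sub>R w k = t k *\<^sub>R z k + (0, \<beta> - \<alpha>)" for k
    using t(1)[of k] by (simp add: w_def prod_eq_iff field_simps)
  then have "(\<lambda>k. t k *\<^sub>R w k) \<longlonglongrightarrow> (x, \<beta>)"
    using tendsto_add[OF lim tendsto_const[of "(0, \<beta> - \<alpha>)"]] by simp
  ultimately show ?thesis
    unfolding horizon_cone_def using t by blast
qed

lemma epi_horizon_fun: "epi (horizon_fun g) = horizon_cone (epi g)"
proof (intro set_eqI, clarify)
  fix x \<alpha>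
  show "(x, \<alpha>) \<in> epi (horizon_fun g) \<longleftrightarrow> (x, \<alpha>) \<in> horizon_cone (epi g)"
  proof
    assume "(x, \<alpha>) \<in> horizon_cone (epi g)"
    then show "(x, \<alpha>) \<in> epi (horizon_fun g)"
      by (auto simp: epi_def horizon_fun_def intro!: Inf_lower)
  next
    assume le: "(x, \<alpha>) \<in> epi (horizon_fun g)"
    have "(x, \<alpha> + inverse (Suc k)) \<in> horizon_cone (epi g)" for k
    proof -
      have "horizon_fun g x < ereal (\<alpha> + inverse (Suc k))"
        using le by (auto simp: epi_def intro: le_less_trans)
      then obtain \<gamma> where "(x, \<gamma>) \<in> horizon_cone (epi g)" "\<gamma> < \<alpha> + inverse (Suc k)"
        by (auto simp: horizon_fun_def Inf_less_iff)
      then show ?thesis using horizon_cone_epi_upward by (meson less_imp_le)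
    qed
    moreover have "(\<lambda>k. (x, \<alpha> + inverse (Suc k))) \<longlonglongrightarrow> (x, \<alpha> + 0)"
      by (intro tendsto_Pair tendsto_add tendsto_const LIMSEQ_inverse_real_of_nat)
    ultimately show "(x, \<alpha>) \<in> horizon_cone (epi g)"
      using closed_sequentially[OF closed_horizon_cone] by fastforce
  qed
qed

text \<open>\<open>min_cone D F\<close> is itself one of the cones over which the intersection is taken.\<close>

lemma min_cone_least:
  assumes "convex D"
  shows "convex_cone (min_cone D F)" "closed (min_cone D F)" "K_convex (min_cone D F) D F"
    and "\<lbrakk>convex_cone K; closed K; K_convex K D F\<rbrakk> \<Longrightarrow> min_cone D F \<subseteq> K"
proof -
  let ?S = "{K. convex_cone K \<and> closed K \<and> K_convex K D F}"
  show "convex_cone (min_cone D F)"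
    by (auto simp: min_cone_def convex_cone_iff)
  show "closed (min_cone D F)"
    by (auto simp: min_cone_def)
  show "K_convex (min_cone D F) D F"
    unfolding K_convex_def convex_def
  proof (clarify)
    fix x y x' y' and u v :: real
    assume a: "(x, y) \<in> K_epi (min_cone D F) D F" "(x', y') \<in> K_epi (min_cone D F) D F"
      and u: "0 \<le> u" "0 \<le> v" "u + v = 1"
    let ?z = "u *\<^sub>R (x, y) + v *\<^sub>R (x', y')"
    have in_K: "?z \<in> K_epi K D F" if "K \<in> ?S" for K
    proof (rule convexD[OF _ _ _ u])
      show "convex (K_epi K D F)" using that by (simp add: K_convex_def)
      show "(x, y) \<in> K_epi K D F" "(x', y') \<in> K_epi K D F"
        using a that by (auto simp: K_epi_def min_cone_def)
    qed
    have "K_epi UNIV D F = D \<times> UNIV"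
      by (auto simp: K_epi_def)
    then have "UNIV \<in> ?S"
      using assms by (auto simp: K_convex_def convex_cone_iff intro: convex_Times)
    then have "fst ?z \<in> D"
      using in_K by (fastforce simp: K_epi_def)
    then show "?z \<in> K_epi (min_cone D F) D F"
      using in_K by (auto simp: K_epi_def min_cone_def)
  qed
  show "min_cone D F \<subseteq> K" if "convex_cone K" "closed K" "K_convex K D F"
    using that by (auto simp: min_cone_def)
qed

end

theory Submission
  imports Defs
begin

text \<open>
  For a closed proper convex \<open>g\<close>, the directions in \<open>hzn g\<close> are exactly those along which
  \<open>g\<close> never increases, whatever the starting point. So for any cone \<open>K\<close>, monotonicity with
  respect to \<open>K\<close> means nothing but \<open>K \<subseteq> - hzn g\<close> (\<open>K_increasing_iff_subset_hzn\<close>), which gives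
  the equivalence of (ii) and (iii) at once.

  Since \<open>- hzn g\<close> is a closed convex cone (\<open>convex_cone_hzn\<close>, \<open>closed_hzn\<close>), a cone \<open>K\<close> as in (i),
  in general neither closed nor convex, can be enlarged to \<open>- hzn g\<close>: the map \<open>F\<close> stays convex
  with respect to the larger cone (\<open>K_convex_mono\<close>), and minimality of \<open>K\<^sub>F = min_cone D F\<close> gives (iii).
  Conversely \<open>K\<^sub>F\<close> itself is a cone for (i) once (ii) is known.

  Finally, taking polars reverses inclusions, and the bipolar theorem
  (\<open>separating_polar_vector\<close>) makes this reversible because \<open>hzn g\<close> is closed and convex; this is
  the equivalence of (iii) and (iv).
\<close>

section \<open>Epigraphs\<close>

lemma closed_epi:
  fixes g :: "'b::metric_space \<Rightarrow> ereal"
  assumes "lsc_fun g"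
  shows "closed (epi g)"
  unfolding closed_sequential_limits
proof (intro allI impI, elim conjE)
  fix z :: "nat \<Rightarrow> 'b \<times> real" and l
  assume z: "\<forall>n. z n \<in> epi g" and lim: "z \<longlonglongrightarrow> l"
  obtain x \<alpha> where l: "l = (x, \<alpha>)" by fastforce
  have lim1: "(\<lambda>n. fst (z n)) \<longlonglongrightarrow> x" and lim2: "(\<lambda>n. snd (z n)) \<longlonglongrightarrow> \<alpha>"
    using tendsto_fst[OF lim] tendsto_snd[OF lim] by (simp_all add: l)
  have "g x \<le> ereal \<alpha>"
  proof (rule ccontr)
    assume "\<not> g x \<le> ereal \<alpha>"
    then obtain c where c: "ereal \<alpha> < ereal c" "ereal c < g x"
      by (meson ereal_dense2 not_le)
    have "g x \<le> Liminf (nhds x) g"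
      using assms by (simp add: lsc_fun_def)
    then have "\<forall>\<^sub>F y in nhds x. ereal c < g y"
      using c(2) by (simp add: le_Liminf_iff)
    then have "\<forall>\<^sub>F n in sequentially. ereal c < g (fst (z n))"
      using lim1 by (rule eventually_compose_filterlim)
    moreover have "\<forall>\<^sub>F n in sequentially. snd (z n) < c"
      using order_tendstoD(2)[OF lim2] c(1) by simp
    ultimately have "\<forall>\<^sub>F n in sequentially. ereal c < g (fst (z n)) \<and> snd (z n) < c"
      by (rule eventually_conj)
    then obtain n where n: "ereal c < g (fst (z n))" "snd (z n) < c"
      using eventually_happens'[OF sequentially_bot] by blast
    have "g (fst (z n)) \<le> ereal (snd (z n))"
      using z by (auto simp: epi_def split_beta)
    also have "\<dots> < ereal c" using n(2) by simp
    finally show False using n(1) by simp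
  qed
  then show "l \<in> epi g" by (simp add: l epi_def)
qed

lemma epi_nonempty:
  assumes "proper_fun g"
  shows "epi g \<noteq> {}"
proof -
  have "\<exists>x. \<bar>g x\<bar> \<noteq> \<infinity>"
    using assms by (simp add: proper_fun_def)
  then obtain x where "\<bar>g x\<bar> \<noteq> \<infinity>" ..
  then have "(x, real_of_ereal (g x)) \<in> epi g"
    by (simp add: epi_def ereal_real')
  then show ?thesis by blast
qed

section \<open>Recession directions of closed convex sets\<close>

text \<open>Rescaling the points \<open>z + k u\<close> of a ray by \<open>1 / k\<close> makes the base point vanish in the limit;
  the shift to \<open>Suc k\<close> keeps the factors positive and finite.\<close>

lemma horizon_coneI_ray:
  assumes ray: "\<And>k::nat. z + real (Suc k) *\<^sub>R u \<in> C"
  shows "u \<in> horizon_cone C"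
proof -
  let ?t = "\<lambda>k. inverse (real (Suc k))"
  have "?t k *\<^sub>R (z + real (Suc k) *\<^sub>R u) = ?t k *\<^sub>R z + u" for k
    by (simp add: scaleR_right_distrib del: of_nat_Suc)
  moreover have "(\<lambda>k. ?t k *\<^sub>R z + u) \<longlonglongrightarrow> 0 *\<^sub>R z + u"
    by (intro tendsto_intros LIMSEQ_inverse_real_of_nat)
  ultimately have "(\<lambda>k. ?t k *\<^sub>R (z + real (Suc k) *\<^sub>R u)) \<longlonglongrightarrow> u"
    by simp
  then show ?thesis
    unfolding horizon_cone_def
    using ray LIMSEQ_inverse_real_of_nat
    by (intro CollectI exI[of _ ?t] exI[of _ "\<lambda>k. z + real (Suc k) *\<^sub>R u"]) auto
qed

text \<open>If \<open>t\<^sub>k x\<^sub>k \<rightarrow> u\<close>, then \<open>z + u\<close> is the limit of the convex combinations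
  \<open>(1 - t\<^sub>k) z + t\<^sub>k x\<^sub>k\<close>.\<close>

lemma horizon_cone_translate:
  assumes "closed C" "convex C" "z \<in> C" "u \<in> horizon_cone C"
  shows "z + u \<in> C"
proof -
  obtain t :: "nat \<Rightarrow> real" and x where t: "\<And>k. t k > 0" "t \<longlonglongrightarrow> 0" "\<And>k. x k \<in> C"
    and lim: "(\<lambda>k. t k *\<^sub>R x k) \<longlonglongrightarrow> u"
    using assms(4) unfolding horizon_cone_def by blast
  have "(\<lambda>k. (1 - t k) *\<^sub>R z + t k *\<^sub>R x k) \<longlonglongrightarrow> (1 - 0) *\<^sub>R z + u"
    by (intro tendsto_intros t lim)
  moreover have "\<forall>\<^sub>F k in sequentially. (1 - t k) *\<^sub>R z + t k *\<^sub>R x k \<in> C"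
    using order_tendstoD(2)[OF t(2) zero_less_one]
  proof eventually_elim
    case (elim k)
    then show ?case
      using t(1)[of k] by (intro convexD[OF assms(2) assms(3) t(3)]) auto
  qed
  ultimately show ?thesis
    using Lim_in_closed_set[OF assms(1) _ sequentially_bot] by fastforce
qed

lemma horizon_cone_scale_pos:
  assumes "u \<in> horizon_cone C" "c > 0"
  shows "c *\<^sub>R u \<in> horizon_cone C"
proof -
  obtain t :: "nat \<Rightarrow> real" and x where t: "\<And>k. t k > 0" "t \<longlonglongrightarrow> 0" "\<And>k. x k \<in> C"
    and lim: "(\<lambda>k. t k *\<^sub>R x k) \<longlonglongrightarrow> u"
    using assms(1) unfolding horizon_cone_def by blast
  have "(\<lambda>k. c * t k) \<longlonglongrightarrow> 0"
    using tendsto_mult_left[OF t(2), of c] by simp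
  moreover have "(\<lambda>k. (c * t k) *\<^sub>R x k) \<longlonglongrightarrow> c *\<^sub>R u"
    using tendsto_scaleR[OF tendsto_const lim, of c] by simp
  moreover have "\<And>k. c * t k > 0" using t(1) assms(2) by simp
  ultimately show ?thesis
    unfolding horizon_cone_def using t(3)
    by (intro CollectI exI[of _ "\<lambda>k. c * t k"] exI[of _ x]) auto
qed

text \<open>Closedness under addition holds because the ray in direction \<open>u + v\<close> stays in \<open>C\<close>: each of
  its points is reached by a translation along a multiple of \<open>u\<close> and then one of \<open>v\<close>.\<close>

lemma convex_cone_horizon_cone:
  assumes "closed C" "convex C" "C \<noteq> {}"
  shows "convex_cone (horizon_cone C)"
  unfolding convex_cone_iff
proof (intro conjI ballI allI impI)
  obtain z where z: "z \<in> C" using assms(3) by blast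
  show zero: "0 \<in> horizon_cone C"
    by (rule horizon_coneI_ray[of z]) (simp add: z)
  show "u + v \<in> horizon_cone C" if uv: "u \<in> horizon_cone C" "v \<in> horizon_cone C" for u v
  proof (rule horizon_coneI_ray)
    fix k :: nat
    have "z + real (Suc k) *\<^sub>R u + real (Suc k) *\<^sub>R v \<in> C"
      by (intro horizon_cone_translate[OF assms(1,2)] horizon_cone_scale_pos uv z) auto
    then show "z + real (Suc k) *\<^sub>R (u + v) \<in> C"
      by (simp only: scaleR_right_distrib add.assoc)
  qed
  show "c *\<^sub>R u \<in> horizon_cone C" if "u \<in> horizon_cone C" "0 \<le> c" for u and c :: real
    using that zero horizon_cone_scale_pos[of u C c] by (cases "c = 0") auto
qed

section \<open>The horizon cone of a closed convex function\<close>

lemma mem_hzn_iff: "x \<in> hzn g \<longleftrightarrow> (x, 0) \<in> horizon_cone (epi g)"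
  unfolding epi_horizon_fun[symmetric] by (simp add: hzn_def epi_def zero_ereal_def)

lemma closed_hzn: "closed (hzn g)"
proof -
  have "hzn g = (\<lambda>x. (x, 0)) -` horizon_cone (epi g)"
    by (auto simp: mem_hzn_iff)
  moreover have "closed ((\<lambda>x. (x, 0::real)) -` horizon_cone (epi g))"
    by (intro closed_vimage closed_horizon_cone continuous_intros)
  ultimately show ?thesis by simp
qed

lemma convex_cone_hzn:
  assumes "proper_fun g" "convex_fun g" "lsc_fun g"
  shows "convex_cone (hzn g)"
proof -
  have "convex_cone (horizon_cone (epi g))"
    using assms closed_epi epi_nonempty
    by (intro convex_cone_horizon_cone) (auto simp: convex_fun_def)
  then have 0: "(0, 0) \<in> horizon_cone (epi g)"
    and add: "\<And>p q. p \<in> horizon_cone (epi g) \<Longrightarrow> q \<in> horizon_cone (epi g) \<Longrightarrow>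
      p + q \<in> horizon_cone (epi g)"
    and scale: "\<And>p c. p \<in> horizon_cone (epi g) \<Longrightarrow> 0 \<le> c \<Longrightarrow>
      c *\<^sub>R p \<in> horizon_cone (epi g)"
    by (auto simp: convex_cone_iff zero_prod_def)
  show ?thesis
    unfolding convex_cone_iff mem_hzn_iff
  proof (intro conjI ballI allI impI 0)
    show "(x + y, 0) \<in> horizon_cone (epi g)" if "x \<in> hzn g" "y \<in> hzn g" for x y
      using add[of "(x, 0)" "(y, 0)"] that by (simp add: mem_hzn_iff)
    show "(c *\<^sub>R x, 0) \<in> horizon_cone (epi g)" if "x \<in> hzn g" "0 \<le> c" for x and c :: real
      using scale[of "(x, 0)" c] that by (simp add: mem_hzn_iff)
  qed
qed

text \<open>Monotonicity bounds \<open>g\<close> along every ray that starts in its domain and runs in a direction of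
  \<open>- K\<close>, so that a horizontal ray stays in the epigraph. Conversely, a horizontal recession direction
  may be added to every point of the epigraph, which keeps each upper bound of \<open>g y\<close> valid at \<open>x\<close>.\<close>

lemma K_increasing_iff_subset_hzn:
  assumes "proper_fun g" "convex_fun g" "lsc_fun g" and "cone K"
  shows "K_increasing K g \<longleftrightarrow> K \<subseteq> uminus ` hzn g"
proof
  assume inc: "K_increasing K g"
  obtain x \<alpha> where x: "g x \<le> ereal \<alpha>"
    using epi_nonempty[OF assms(1)] by (auto simp: epi_def)
  show "K \<subseteq> uminus ` hzn g"
  proof
    fix v assume v: "v \<in> K"
    have "(- v, 0) \<in> horizon_cone (epi g)"
    proof (rule horizon_coneI_ray[of "(x, \<alpha>)"])
      fix k :: nat
      have "real (Suc k) *\<^sub>R v \<in> K"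
        using assms(4) v by (simp add: cone_def)
      then have "x - (x - real (Suc k) *\<^sub>R v) \<in> K"
        by simp
      then have "g (x - real (Suc k) *\<^sub>R v) \<le> g x"
        using inc unfolding K_increasing_def by blast
      then show "(x, \<alpha>) + real (Suc k) *\<^sub>R (- v, 0) \<in> epi g"
        using x by (simp add: epi_def)
    qed
    then show "v \<in> uminus ` hzn g"
      by (intro image_eqI[of _ _ "- v"]) (simp_all add: mem_hzn_iff)
  qed
next
  assume sub: "K \<subseteq> uminus ` hzn g"
  show "K_increasing K g"
    unfolding K_increasing_def
  proof (intro allI impI)
    fix x y assume "y - x \<in> K"
    then obtain h where "h \<in> hzn g" "y - x = - h"
      using sub by blast
    then have dir: "(x - y, 0) \<in> horizon_cone (epi g)"
      by (metis mem_hzn_iff minus_diff_eq minus_minus)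
    have bound: "g x \<le> ereal \<alpha>" if "g y \<le> ereal \<alpha>" for \<alpha>
    proof -
      have "(y, \<alpha>) + (x - y, 0) \<in> epi g"
        using assms(2) closed_epi[OF assms(3)] dir that
        by (intro horizon_cone_translate) (auto simp: convex_fun_def epi_def)
      then show ?thesis by (simp add: epi_def)
    qed
    show "g x \<le> g y"
      by (rule ereal_le_real) (use bound in blast)
  qed
qed

section \<open>Enlarging the cone, and polarity\<close>

text \<open>Convexity of the \<open>K\<close>-epigraph is applied only to points of the graph of \<open>F\<close>, which lie in it
  because \<open>0 \<in> K\<close>; the differences \<open>y - F x\<close> of general points are absorbed by the convex
  cone \<open>L\<close>.\<close>

lemma K_convex_mono:
  assumes "K_convex K D F" "0 \<in> K" "K \<subseteq> L" "convex_cone L"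
  shows "K_convex L D F"
  unfolding K_convex_def convex_def
proof (clarify)
  fix x y x' y' and u v :: real
  assume a: "(x, y) \<in> K_epi L D F" "(x', y') \<in> K_epi L D F"
    and u: "0 \<le> u" "0 \<le> v" "u + v = 1"
  let ?x = "u *\<^sub>R x + v *\<^sub>R x'"
  have "u *\<^sub>R (x, F x) + v *\<^sub>R (x', F x') \<in> K_epi K D F"
    using assms(1,2) a u unfolding K_convex_def
    by (intro convexD) (auto simp: K_epi_def)
  then have D: "?x \<in> D" and graph: "u *\<^sub>R F x + v *\<^sub>R F x' - F ?x \<in> L"
    using assms(3) by (auto simp: K_epi_def)
  have "u *\<^sub>R (y - F x) + v *\<^sub>R (y' - F x') + (u *\<^sub>R F x + v *\<^sub>R F x' - F ?x) \<in> L"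
    using a u graph assms(4) by (auto simp: K_epi_def convex_cone_iff)
  then have "u *\<^sub>R y + v *\<^sub>R y' - F ?x \<in> L"
    by (simp add: algebra_simps)
  then show "u *\<^sub>R (x, y) + v *\<^sub>R (x', y') \<in> K_epi L D F"
    using D by (simp add: K_epi_def)
qed

text \<open>This is the nontrivial half of the bipolar theorem. A hyperplane that strictly separates
  \<open>z\<close> from \<open>H\<close> can be moved to the origin: a linear functional that is bounded below on a cone is
  nonnegative there.\<close>

lemma separating_polar_vector:
  fixes H :: "'b::euclidean_space set"
  assumes "convex_cone H" "closed H" "z \<notin> H"
  obtains v where "v \<in> polar_cone H" "z \<bullet> v > 0"
proof -
  have H: "0 \<in> H" "\<And>x c. x \<in> H \<Longrightarrow> 0 \<le> c \<Longrightarrow> c *\<^sub>R x \<in> H"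
    using assms(1) by (auto simp: convex_cone_iff)
  have "convex H" using assms(1) by (simp add: convex_cone_def)
  then obtain a b where ab: "a \<bullet> z < b" "\<And>x. x \<in> H \<Longrightarrow> b < a \<bullet> x"
    using separating_hyperplane_closed_point assms(2,3) by metis
  have b: "b < 0" using ab(2)[OF H(1)] by simp
  have "0 \<le> a \<bullet> x" if x: "x \<in> H" for x
  proof (rule ccontr)
    assume neg: "\<not> 0 \<le> a \<bullet> x"
    \<comment> \<open>The factor is chosen so that the functional takes exactly the forbidden value \<open>b\<close>.\<close>
    have "(b / (a \<bullet> x)) *\<^sub>R x \<in> H"
      using neg b x by (intro H(2)) (auto intro: divide_nonpos_nonpos)
    from ab(2)[OF this] neg show False by simp
  qed
  then have "- a \<in> polar_cone H"
    by (simp add: polar_cone_def inner_commute)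
  moreover have "z \<bullet> (- a) > 0"
    using ab(1) b by (simp add: inner_commute)
  ultimately show ?thesis by (rule that)
qed

lemma subset_uminus_iff_polar:
  fixes H K :: "'b::euclidean_space set"
  assumes "convex_cone H" "closed H"
  shows "K \<subseteq> uminus ` H \<longleftrightarrow> polar_cone H \<subseteq> uminus ` polar_cone K"
proof
  assume sub: "K \<subseteq> uminus ` H"
  show "polar_cone H \<subseteq> uminus ` polar_cone K"
  proof
    fix v assume "v \<in> polar_cone H"
    then have "- v \<in> polar_cone K"
      using sub by (force simp: polar_cone_def)
    then show "v \<in> uminus ` polar_cone K"
      by (intro image_eqI[of _ _ "- v"]) simp_all
  qed
next
  assume sub: "polar_cone H \<subseteq> uminus ` polar_cone K"
  show "K \<subseteq> uminus ` H"
  proof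
    fix k assume k: "k \<in> K"
    have "- k \<in> H"
    proof (rule ccontr)
      assume "- k \<notin> H"
      then obtain v where v: "v \<in> polar_cone H" "- k \<bullet> v > 0"
        using separating_polar_vector[OF assms] by blast
      then have "- v \<in> polar_cone K" using sub by auto
      then show False using k v(2) by (force simp: polar_cone_def)
    qed
    then show "k \<in> uminus ` H"
      by (intro image_eqI[of _ _ "- k"]) simp_all
  qed
qed

section \<open>The equivalences\<close>


theorem proposition57:
  fixes D :: "'a::euclidean_space set"
    and F :: "'a \<Rightarrow> 'b::euclidean_space"
    and g :: "'b \<Rightarrow> ereal"
  assumes "proper_fun g" and "convex_fun g" and "lsc_fun g"
    and "convex D"
    and "proper_fun (comp_on g D F)"
  shows "((\<exists>K. K \<noteq> {} \<and> cone K \<and> K_increasing K g \<and> K_convex K D F)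
            \<longleftrightarrow> K_increasing (min_cone D F) g)
       \<and> (K_increasing (min_cone D F) g \<longleftrightarrow> min_cone D F \<subseteq> uminus ` hzn g)
       \<and> (min_cone D F \<subseteq> uminus ` hzn g
            \<longleftrightarrow> polar_cone (hzn g) \<subseteq> uminus ` polar_cone (min_cone D F))"
proof -
  let ?L = "uminus ` hzn g"
  have hzn: "convex_cone (hzn g)"
    by (rule convex_cone_hzn[OF assms(1-3)])
  have L: "convex_cone ?L" "closed ?L"
    using convex_cone_linear_image[of "hzn g" uminus] hzn
      closed_negations[OF closed_hzn[of g]]
    by (simp_all add: linear_uminus)
  note min = min_cone_least[OF \<open>convex D\<close>, where F = F]
  have min_cone: "min_cone D F \<noteq> {}" "cone (min_cone D F)"
    using min(1) by (auto simp: convex_cone_iff cone_def)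
  note incr_iff = K_increasing_iff_subset_hzn[OF assms(1-3)]
  have "min_cone D F \<subseteq> ?L"
    if "K \<noteq> {}" "cone K" "K_increasing K g" "K_convex K D F" for K
  proof -
    have "K \<subseteq> ?L" using incr_iff that by blast
    moreover have "0 \<in> K" using that cone_contains_0 by blast
    ultimately have "K_convex ?L D F"
      using K_convex_mono L(1) that(4) by blast
    then show ?thesis using min(4) L by blast
  qed
  then show ?thesis
    using incr_iff[OF min_cone(2)] min_cone min(3)
      subset_uminus_iff_polar[OF hzn closed_hzn, of "min_cone D F"]
    by blast
qed

end
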